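(* Let $F:\bar L^0\to\bar L^0$ be a local, increasing function. Then: (i) any conditional inverse $G$ of $F$ satisfies $F^{(-1,l)}=G^-\le G\le G^+=F^{(-1,r)}$; (ii) $F^{(-1,l)}$ and $F^{(-1,r)}$ are also both conditional inverses of $F$; (iii) $F$ is a conditional inverse of any of its conditional inverses; (iv) for any $m,s\in\bar L^0$, $$F^-(m)\le s\iff m\le F^{(-1,r)}(s),\qquad F^+(m)\ge s\iff m\ge F^{(-1,l)}(s).$$
   Context: $(\Omega,\mathscr G,P)$ is a probability space; $\bar L^0$ is the set of $\mathscr G$-measurable $[-\infty,\infty]$-valued random variables, identified when $P$-a.s. equal; (in)equalities between elements of $\bar L^0$ are $P$-a.s. (in particular $n<m$ means $P[n<m]=1$) and "on $A$" means a.s. on $A$; $0\cdot(\pm\infty)=0$. $F:\bar L^0\to\bar L^0$ is local if $F(1_Am+1_{A^c}n)=1_AF(m)+1_{A^c}F(n)$ for all $A\in\mathscr G$, and increasing if $F(m)\ge F(m')$ whenever $m\ge m'$. For local increasing $F$, its left- and right-continuous versions are, with $\widetilde A_m=\{m>-\infty\}$, $\widetilde B_m=\{m<\infty\}$, $$F^-(m)=1_{\widetilde A_m}\operatorname{ess\,sup}\{F(n):n\in\bar L^0,\ n<m\text{ on }\widetilde A_m\}-1_{\widetilde A_m^c}\infty,$$ $$F^+(m)=1_{\widetilde B_m}\operatorname{ess\,inf}\{F(n):n\in\bar L^0,\ n>m\text{ on }\widetilde B_m\}+1_{\widetilde B_m^c}\infty.$$ A local, increasing function $G:\bar L^0\to\bar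 L^0$ is a conditional inverse of $F$ if for every $s\in\bar L^0$: $F^-(G(s))\le s\le F^+(G(s))$ on $\{F(-\infty)<s<F(\infty)\}$; $G(s)=-\infty$ on $\{s<F(-\infty)\}$; $G(s)=\infty$ on $\{F(\infty)<s\}$. The conditional left- and right-inverses of $F$ are, with $A_s=\{F(\infty)\ge s\}$ and $B_s=\{F(-\infty)\le s\}$, $$F^{(-1,l)}(s)=1_{A_s}\operatorname{ess\,inf}\{m\in\bar L^0:1_{A_s}F(m)\ge1_{A_s}s\}+1_{A_s^c}\infty,$$ $$F^{(-1,r)}(s)=1_{B_s}\operatorname{ess\,sup}\{m\in\bar L^0:1_{B_s}F(m)\le1_{B_s}s\}-1_{B_s^c}\infty.$$ *)

theory Defs
  imports "HOL-Probability.Probability"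
begin

text \<open>
  Extended-real random variables identified up to almost sure equality are represented by
  measurable functions, with every equality and inequality between them read almost surely.
  Type \<open>ereal\<close> satisfies \<open>0 * \<infinity> = 0\<close> and \<open>0 * (-\<infinity>) = 0\<close>, and the sums of complementary
  indicator terms below never add infinities of opposite sign.
\<close>

abbreviation L0bar :: "'a measure \<Rightarrow> ('a \<Rightarrow> ereal) set" where
  "L0bar M \<equiv> borel_measurable M"

definition glue :: "'a set \<Rightarrow> ('a \<Rightarrow> ereal) \<Rightarrow> ('a \<Rightarrow> ereal) \<Rightarrow> 'a \<Rightarrow> ereal" where
  "glue A m n = (\<lambda>x. indicator A x * m x + indicator (- A) x * n x)"

text \<open>The second conjunct says that the map is well defined on classes of a.s. equal functions.\<close>

definition L0bar_map :: "'a measure \<Rightarrow> (('a \<Rightarrow> ereal) \<Rightarrow> ('a \<Rightarrow> ereal)) \<Rightarrow> bool" where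
  "L0bar_map M F \<longleftrightarrow>
     (\<forall>m\<in>L0bar M. F m \<in> L0bar M) \<and>
     (\<forall>m\<in>L0bar M. \<forall>n\<in>L0bar M. (AE x in M. m x = n x) \<longrightarrow> (AE x in M. F m x = F n x))"

definition local_map :: "'a measure \<Rightarrow> (('a \<Rightarrow> ereal) \<Rightarrow> ('a \<Rightarrow> ereal)) \<Rightarrow> bool" where
  "local_map M F \<longleftrightarrow>
     (\<forall>A\<in>sets M. \<forall>m\<in>L0bar M. \<forall>n\<in>L0bar M.
        AE x in M. F (glue A m n) x = glue A (F m) (F n) x)"

definition increasing_map :: "'a measure \<Rightarrow> (('a \<Rightarrow> ereal) \<Rightarrow> ('a \<Rightarrow> ereal)) \<Rightarrow> bool" where
  "increasing_map M F \<longleftrightarrow>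
     (\<forall>m\<in>L0bar M. \<forall>m'\<in>L0bar M.
        (AE x in M. m' x \<le> m x) \<longrightarrow> (AE x in M. F m' x \<le> F m x))"

definition local_increasing :: "'a measure \<Rightarrow> (('a \<Rightarrow> ereal) \<Rightarrow> ('a \<Rightarrow> ereal)) \<Rightarrow> bool" where
  "local_increasing M F \<longleftrightarrow> L0bar_map M F \<and> local_map M F \<and> increasing_map M F"

text \<open>
  Essential supremum and infimum of a family of random variables: the least upper and greatest
  lower bound for the a.s. order. (The library constant \<^const>\<open>esssup\<close> is the essential
  supremum of a single function, hence a number.) On a probability space they exist for every
  family in \<^term>\<open>L0bar M\<close> and are a.s. unique, so only a representative is chosen here.
\<close>

definition is_ess_Sup :: "'a measure \<Rightarrow> ('a \<Rightarrow> ereal) set \<Rightarrow> ('a \<Rightarrow> ereal) \<Rightarrow> bool" where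
  "is_ess_Sup M S Z \<longleftrightarrow> Z \<in> L0bar M \<and> (\<forall>X\<in>S. AE x in M. X x \<le> Z x) \<and>
     (\<forall>Y\<in>L0bar M. (\<forall>X\<in>S. AE x in M. X x \<le> Y x) \<longrightarrow> (AE x in M. Z x \<le> Y x))"

definition ess_Sup :: "'a measure \<Rightarrow> ('a \<Rightarrow> ereal) set \<Rightarrow> 'a \<Rightarrow> ereal" where
  "ess_Sup M S = (SOME Z. is_ess_Sup M S Z)"

definition is_ess_Inf :: "'a measure \<Rightarrow> ('a \<Rightarrow> ereal) set \<Rightarrow> ('a \<Rightarrow> ereal) \<Rightarrow> bool" where
  "is_ess_Inf M S Z \<longleftrightarrow> Z \<in> L0bar M \<and> (\<forall>X\<in>S. AE x in M. Z x \<le> X x) \<and>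
     (\<forall>Y\<in>L0bar M. (\<forall>X\<in>S. AE x in M. Y x \<le> X x) \<longrightarrow> (AE x in M. Y x \<le> Z x))"

definition ess_Inf :: "'a measure \<Rightarrow> ('a \<Rightarrow> ereal) set \<Rightarrow> 'a \<Rightarrow> ereal" where
  "ess_Inf M S = (SOME Z. is_ess_Inf M S Z)"

definition left_version ::
  "'a measure \<Rightarrow> (('a \<Rightarrow> ereal) \<Rightarrow> ('a \<Rightarrow> ereal)) \<Rightarrow> ('a \<Rightarrow> ereal) \<Rightarrow> 'a \<Rightarrow> ereal" where
  "left_version M F m =
     (let A = {x \<in> space M. m x > -\<infinity>} in
      glue A (ess_Sup M (F ` {n \<in> L0bar M. AE x in M. x \<in> A \<longrightarrow> n x < m x})) (\<lambda>_. -\<infinity>))"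

definition right_version ::
  "'a measure \<Rightarrow> (('a \<Rightarrow> ereal) \<Rightarrow> ('a \<Rightarrow> ereal)) \<Rightarrow> ('a \<Rightarrow> ereal) \<Rightarrow> 'a \<Rightarrow> ereal" where
  "right_version M F m =
     (let B = {x \<in> space M. m x < \<infinity>} in
      glue B (ess_Inf M (F ` {n \<in> L0bar M. AE x in M. x \<in> B \<longrightarrow> n x > m x})) (\<lambda>_. \<infinity>))"

definition conditional_inverse ::
  "'a measure \<Rightarrow> (('a \<Rightarrow> ereal) \<Rightarrow> ('a \<Rightarrow> ereal)) \<Rightarrow> (('a \<Rightarrow> ereal) \<Rightarrow> ('a \<Rightarrow> ereal)) \<Rightarrow> bool" where
  "conditional_inverse M F G \<longleftrightarrow>
     local_increasing M G \<and>
     (\<forall>s\<in>L0bar M.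
        (AE x in M. F (\<lambda>_. -\<infinity>) x < s x \<and> s x < F (\<lambda>_. \<infinity>) x \<longrightarrow>
            left_version M F (G s) x \<le> s x \<and> s x \<le> right_version M F (G s) x) \<and>
        (AE x in M. s x < F (\<lambda>_. -\<infinity>) x \<longrightarrow> G s x = -\<infinity>) \<and>
        (AE x in M. F (\<lambda>_. \<infinity>) x < s x \<longrightarrow> G s x = \<infinity>))"

definition left_inverse ::
  "'a measure \<Rightarrow> (('a \<Rightarrow> ereal) \<Rightarrow> ('a \<Rightarrow> ereal)) \<Rightarrow> ('a \<Rightarrow> ereal) \<Rightarrow> 'a \<Rightarrow> ereal" where
  "left_inverse M F s =
     (let A = {x \<in> space M. F (\<lambda>_. \<infinity>) x \<ge> s x} in
      glue A
        (ess_Inf M {m \<in> L0bar M. AE x in M. indicator A x * F m x \<ge> indicator A x * s x})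
        (\<lambda>_. \<infinity>))"

definition right_inverse ::
  "'a measure \<Rightarrow> (('a \<Rightarrow> ereal) \<Rightarrow> ('a \<Rightarrow> ereal)) \<Rightarrow> ('a \<Rightarrow> ereal) \<Rightarrow> 'a \<Rightarrow> ereal" where
  "right_inverse M F s =
     (let B = {x \<in> space M. F (\<lambda>_. -\<infinity>) x \<le> s x} in
      glue B
        (ess_Sup M {m \<in> L0bar M. AE x in M. indicator B x * F m x \<le> indicator B x * s x})
        (\<lambda>_. -\<infinity>))"

end

theory Submission
  imports Defs
begin

text \<open>
  A local increasing map satisfies \<open>m x \<le> n x \<longrightarrow> F m x \<le> F n x\<close> almost surely, for arbitrary
  \<open>m\<close> and \<open>n\<close>. Comparing with the countably many rational constants \<open>q\<close> turns every essential
  supremum and infimum in the statement into a countable one: \<open>F\<^sup>-(m) = sup {F(q) | q < m}\<close>,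
  \<open>F\<^sup>+(m) = inf {F(q) | q > m}\<close>, and the left- and right-inverses at \<open>s\<close> are
  \<open>inf {q | s \<le> F(q)}\<close> and \<open>sup {q | F(q) \<le> s}\<close>. Moreover \<open>G\<close> is a conditional inverse of \<open>F\<close>
  iff a.s. \<open>F(p) < t \<longrightarrow> p \<le> G(t)\<close> and \<open>t < F(p) \<longrightarrow> G(t) \<le> p\<close> for all \<open>p\<close> and \<open>t\<close>, a condition
  symmetric in \<open>F\<close> and \<open>G\<close>. Each claim then follows pointwise.
\<close>

section \<open>Rational density and point-dependent index sets in the extended reals\<close>

abbreviation ereal_of_rat :: "rat \<Rightarrow> ereal" where
  "ereal_of_rat q \<equiv> ereal (real_of_rat q)"

lemma ereal_le_by_rat_below:
  fixes a b :: ereal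
  assumes "\<And>q. ereal_of_rat q < a \<Longrightarrow> ereal_of_rat q \<le> b"
  shows "a \<le> b"
  using assms ereal_dense3[of b a] by (metis not_le)

lemma ereal_le_by_rat_above:
  fixes a b :: ereal
  assumes "\<And>q. b < ereal_of_rat q \<Longrightarrow> a \<le> ereal_of_rat q"
  shows "a \<le> b"
  using assms ereal_dense3[of b a] by (metis not_le)

text \<open>Needed for measurability: in the suprema below the index set depends on the point. The
  left side ranges over a fixed countable type, with -\<infinity> as neutral value for excluded
  indices.\<close>

lemma SUP_if_eq:
  fixes f :: "'i \<Rightarrow> ereal"
  shows "(SUP i. if P i then f i else -\<infinity>) = (SUP i\<in>{i. P i}. f i)"
proof (rule antisym)
  show "(SUP i. if P i then f i else -\<infinity>) \<le> (SUP i\<in>{i. P i}. f i)"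
    by (rule SUP_least) (simp add: SUP_upper)
  show "(SUP i\<in>{i. P i}. f i) \<le> (SUP i. if P i then f i else -\<infinity>)"
  proof (rule SUP_least)
    fix i assume "i \<in> {i. P i}"
    then show "f i \<le> (SUP i. if P i then f i else -\<infinity>)"
      using SUP_upper[of i UNIV "\<lambda>i. if P i then f i else -\<infinity>"] by simp
  qed
qed

lemma INF_if_eq:
  fixes f :: "'i \<Rightarrow> ereal"
  shows "(INF i. if P i then f i else \<infinity>) = (INF i\<in>{i. P i}. f i)"
proof (rule antisym)
  show "(INF i\<in>{i. P i}. f i) \<le> (INF i. if P i then f i else \<infinity>)"
    by (rule INF_greatest) (simp add: INF_lower)
  show "(INF i. if P i then f i else \<infinity>) \<le> (INF i\<in>{i. P i}. f i)"
  proof (rule INF_greatest)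
    fix i assume "i \<in> {i. P i}"
    then show "(INF i. if P i then f i else \<infinity>) \<le> f i"
      using INF_lower[of i UNIV "\<lambda>i. if P i then f i else \<infinity>"] by simp
  qed
qed

section \<open>Gluing and pointwise monotonicity of local increasing maps\<close>

lemma glue_apply: "glue A m n x = (if x \<in> A then m x else n x)"
  by (simp add: glue_def)

lemma glue_in_L0bar:
  assumes "A \<in> sets M" "m \<in> L0bar M" "n \<in> L0bar M"
  shows "glue A m n \<in> L0bar M"
proof -
  have "(\<lambda>x. if x \<in> A then m x else n x) \<in> L0bar M"
    using assms by measurable
  then show ?thesis
    by (simp add: glue_apply[abs_def])
qed

lemma local_increasing_in_L0bar:
  "local_increasing M F \<Longrightarrow> m \<in> L0bar M \<Longrightarrow> F m \<in> L0bar M"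
  by (simp add: local_increasing_def L0bar_map_def)

text \<open>Locality localizes monotonicity. Replacing \<open>m\<close> by \<open>n\<close> wherever
  \<open>m \<le> n\<close> fails gives a function below \<open>n\<close> everywhere, and locality
  identifies its image with \<open>F m\<close> where \<open>m \<le> n\<close>.\<close>

lemma local_increasing_mono:
  assumes F: "local_increasing M F" and m: "m \<in> L0bar M" and n: "n \<in> L0bar M"
  shows "AE x in M. m x \<le> n x \<longrightarrow> F m x \<le> F n x"
proof -
  define A where "A = {x \<in> space M. m x \<le> n x}"
  have A: "A \<in> sets M"
    unfolding A_def using m n by measurable
  have "AE x in M. F (glue A m n) x = glue A (F m) (F n) x"
    using F m n A by (simp add: local_increasing_def local_map_def)
  moreover have "AE x in M. F (glue A m n) x \<le> F n x"
  proof -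
    have "AE x in M. glue A m n x \<le> n x"
      by (simp add: glue_apply A_def)
    then show ?thesis
      using F m n glue_in_L0bar[OF A m n]
      by (simp add: local_increasing_def increasing_map_def)
  qed
  ultimately show ?thesis
    using AE_space by eventually_elim (auto simp: glue_apply A_def)
qed

text \<open>Pointwise monotonicity used in both directions gives \<open>F m = F n\<close> almost
  surely where \<open>m = n\<close>. Locality follows by comparing \<open>glue A m n\<close> with
  \<open>m\<close> on \<open>A\<close> and with \<open>n\<close> off \<open>A\<close>.\<close>

lemma local_increasingI:
  assumes cl: "\<And>m. m \<in> L0bar M \<Longrightarrow> F m \<in> L0bar M"
    and mono: "\<And>m n. m \<in> L0bar M \<Longrightarrow> n \<in> L0bar M \<Longrightarrow> AE x in M. m x \<le> n x \<longrightarrow> F m x \<le> F n x"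
  shows "local_increasing M F"
proof -
  have eq: "AE x in M. m x = n x \<longrightarrow> F m x = F n x" if "m \<in> L0bar M" "n \<in> L0bar M" for m n
    using mono[OF that] mono[OF that(2,1)] by eventually_elim auto
  have "AE x in M. F m x = F n x"
    if "m \<in> L0bar M" "n \<in> L0bar M" "AE x in M. m x = n x" for m n
    using eq[OF that(1,2)] that(3) by eventually_elim auto
  moreover have "AE x in M. F (glue A m n) x = glue A (F m) (F n) x"
    if A: "A \<in> sets M" and m: "m \<in> L0bar M" and n: "n \<in> L0bar M" for A m n
    using eq[OF glue_in_L0bar[OF A m n] m] eq[OF glue_in_L0bar[OF A m n] n]
    by eventually_elim (auto simp: glue_apply)
  moreover have "AE x in M. F m x \<le> F n x"
    if "m \<in> L0bar M" "n \<in> L0bar M" "AE x in M. m x \<le> n x" for m n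
    using mono[OF that(1,2)] that(3) by eventually_elim auto
  ultimately show ?thesis
    using cl
    by (simp add: local_increasing_def L0bar_map_def local_map_def increasing_map_def)
qed

section \<open>Essential bounds and monotonicity on a common null set\<close>

text \<open>Two least upper bounds bound each other, so one explicit witness \<open>Z\<close> both
  shows existence and determines the representative picked by \<open>SOME\<close> up to a null
  set.\<close>

lemma ess_Sup_eq:
  assumes "is_ess_Sup M S Z"
  shows "ess_Sup M S \<in> L0bar M" "AE x in M. ess_Sup M S x = Z x"
proof -
  have *: "is_ess_Sup M S (ess_Sup M S)"
    unfolding ess_Sup_def using assms by (rule someI[of "is_ess_Sup M S"])
  then show "ess_Sup M S \<in> L0bar M"
    by (simp add: is_ess_Sup_def)
  have "AE x in M. ess_Sup M S x \<le> Z x" "AE x in M. Z x \<le> ess_Sup M S x"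
    using * assms by (simp_all add: is_ess_Sup_def)
  then show "AE x in M. ess_Sup M S x = Z x"
    by eventually_elim auto
qed

lemma ess_Inf_eq:
  assumes "is_ess_Inf M S Z"
  shows "ess_Inf M S \<in> L0bar M" "AE x in M. ess_Inf M S x = Z x"
proof -
  have *: "is_ess_Inf M S (ess_Inf M S)"
    unfolding ess_Inf_def using assms by (rule someI[of "is_ess_Inf M S"])
  then show "ess_Inf M S \<in> L0bar M"
    by (simp add: is_ess_Inf_def)
  have "AE x in M. ess_Inf M S x \<le> Z x" "AE x in M. Z x \<le> ess_Inf M S x"
    using * assms by (simp_all add: is_ess_Inf_def)
  then show "AE x in M. ess_Inf M S x = Z x"
    by eventually_elim auto
qed

text \<open>Each comparison has its own exceptional null set. As the rationals are countable, one
  null set serves all \<open>q\<close>, so that \<open>q\<close> may later be chosen depending on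
  the point \<open>x\<close>.\<close>

lemma local_increasing_mono_rat:
  assumes F: "local_increasing M F" and m: "m \<in> L0bar M"
  shows "AE x in M. \<forall>q. (m x \<le> ereal_of_rat q \<longrightarrow> F m x \<le> F (\<lambda>_. ereal_of_rat q) x) \<and>
                        (ereal_of_rat q \<le> m x \<longrightarrow> F (\<lambda>_. ereal_of_rat q) x \<le> F m x)"
proof (unfold AE_all_countable, intro allI)
  fix q
  show "AE x in M. (m x \<le> ereal_of_rat q \<longrightarrow> F m x \<le> F (\<lambda>_. ereal_of_rat q) x) \<and>
                   (ereal_of_rat q \<le> m x \<longrightarrow> F (\<lambda>_. ereal_of_rat q) x \<le> F m x)"
    using local_increasing_mono[OF F m, of "\<lambda>_. ereal_of_rat q"]
      local_increasing_mono[OF F _ m, of "\<lambda>_. ereal_of_rat q"]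
    by simp
qed

lemma local_increasing_mono_rats:
  assumes F: "local_increasing M F"
  shows "AE x in M. \<forall>p q. p \<le> q \<longrightarrow> F (\<lambda>_. ereal_of_rat p) x \<le> F (\<lambda>_. ereal_of_rat q) x"
proof (unfold AE_all_countable, intro allI)
  fix p q
  show "AE x in M. p \<le> q \<longrightarrow> F (\<lambda>_. ereal_of_rat p) x \<le> F (\<lambda>_. ereal_of_rat q) x"
    using local_increasing_mono[OF F, of "\<lambda>_. ereal_of_rat p" "\<lambda>_. ereal_of_rat q"]
    by (simp add: of_rat_less_eq)
qed

section \<open>One-sided versions as countable suprema and infima\<close>

text \<open>Off \<open>A\<close> the family is unconstrained, so its supremum there is the value at
  the constant \<infinity>. On \<open>A\<close> a rational between \<open>n x\<close> and
  \<open>m x\<close> bounds \<open>F n x\<close>, and suitable members of the family show that the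
  bound is least.\<close>

lemma ess_Sup_left_version:
  assumes F: "local_increasing M F" and m [measurable]: "m \<in> L0bar M"
    and A_def: "A = {x \<in> space M. m x > -\<infinity>}"
  shows "is_ess_Sup M (F ` {n \<in> L0bar M. AE x in M. x \<in> A \<longrightarrow> n x < m x})
    (glue A (\<lambda>x. SUP q\<in>{q. ereal_of_rat q < m x}. F (\<lambda>_. ereal_of_rat q) x) (F (\<lambda>_. \<infinity>)))"
    (is "is_ess_Sup M (F ` ?N) (glue A ?Z _)")
proof -
  have [measurable]: "F (\<lambda>_. c) \<in> L0bar M" for c
    by (rule local_increasing_in_L0bar[OF F]) simp
  have A [measurable]: "A \<in> sets M"
    unfolding A_def by measurable
  have "(\<lambda>x. SUP q. if ereal_of_rat q < m x then F (\<lambda>_. ereal_of_rat q) x else -\<infinity>) \<in> L0bar M"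
    by measurable
  then have "?Z \<in> L0bar M"
    by (simp only: SUP_if_eq)
  then have Z: "glue A ?Z (F (\<lambda>_. \<infinity>)) \<in> L0bar M"
    by (intro glue_in_L0bar) simp_all
  have "AE x in M. F n x \<le> glue A ?Z (F (\<lambda>_. \<infinity>)) x" if n: "n \<in> ?N" for n
  proof -
    have nL: "n \<in> L0bar M" and ineq: "AE x in M. x \<in> A \<longrightarrow> n x < m x"
      using n by auto
    have "AE x in M. n x \<le> \<infinity> \<longrightarrow> F n x \<le> F (\<lambda>_. \<infinity>) x"
      by (rule local_increasing_mono[OF F nL]) simp
    then show ?thesis
      using ineq local_increasing_mono_rat[OF F nL]
    proof eventually_elim
      case (elim x)
      show ?case
      proof (cases "x \<in> A")
        case True
        then obtain q where "n x < ereal_of_rat q" "ereal_of_rat q < m x"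
          using elim ereal_dense3[of "n x" "m x"] by auto
        then show ?thesis
          using True elim by (auto simp: glue_apply intro!: SUP_upper2[of q])
      qed (use elim in \<open>simp add: glue_apply\<close>)
    qed
  qed
  moreover have "AE x in M. glue A ?Z (F (\<lambda>_. \<infinity>)) x \<le> Y x"
    if Y: "Y \<in> L0bar M" "\<And>n. n \<in> ?N \<Longrightarrow> AE x in M. F n x \<le> Y x" for Y
  proof -
    \<comment> \<open>A member of the family that equals \<open>q\<close> wherever this is
      admissible: elsewhere on \<open>A\<close> the value -\<infinity> is still below
      \<open>m\<close>, and off \<open>A\<close> the value \<infinity> reaches the largest
      image.\<close>
    define n where "n q = glue {x \<in> space M. ereal_of_rat q < m x} (\<lambda>_. ereal_of_rat q)
      (glue A (\<lambda>_. -\<infinity>) (\<lambda>_. \<infinity>))" for q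
    have nL: "n q \<in> L0bar M" for q
      unfolding n_def by (intro glue_in_L0bar) simp_all
    have "n q \<in> ?N" for q
      using nL by (auto simp: n_def glue_apply A_def)
    then have "AE x in M. \<forall>q. F (n q) x \<le> Y x"
      unfolding AE_all_countable using Y(2) by blast
    moreover have "AE x in M. \<forall>q. ereal_of_rat q \<le> n q x \<longrightarrow> F (\<lambda>_. ereal_of_rat q) x \<le> F (n q) x"
      unfolding AE_all_countable
      by (intro allI local_increasing_mono[OF F]) (simp_all add: nL)
    \<comment> \<open>The index 0 is an arbitrary choice: off \<open>A\<close> no rational lies
      below \<open>m\<close>, so every \<open>n q\<close> is \<infinity> there.\<close>
    moreover have "AE x in M. \<infinity> \<le> n 0 x \<longrightarrow> F (\<lambda>_. \<infinity>) x \<le> F (n 0) x"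
      by (intro local_increasing_mono[OF F]) (simp_all add: nL)
    ultimately show ?thesis
      using AE_space
    proof eventually_elim
      case (elim x)
      show ?case
      proof (cases "x \<in> A")
        case True
        have "F (\<lambda>_. ereal_of_rat q) x \<le> Y x" if "ereal_of_rat q < m x" for q
        proof -
          have "n q x = ereal_of_rat q"
            using that elim by (simp add: n_def glue_apply)
          then show ?thesis
            using elim by (metis order_refl order_trans)
        qed
        then show ?thesis
          using True by (auto simp: glue_apply intro!: SUP_least)
      next
        case False
        then have "n 0 x = \<infinity>"
          using elim by (auto simp: n_def glue_apply A_def)
        then have "F (\<lambda>_. \<infinity>) x \<le> Y x"
          using elim by (metis order_refl order_trans)
        then show ?thesis
          using False by (simp add: glue_apply)
      qed
    qed
  qed
  ultimately show ?thesis
    using Z unfolding is_ess_Sup_def by blast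
qed

text \<open>Where \<open>m\<close> is -\<infinity> the index set is empty and the supremum is
  -\<infinity>, in agreement with the second branch of \<open>left_version\<close>.\<close>

lemma left_version_eq:
  assumes F: "local_increasing M F" and m: "m \<in> L0bar M"
  shows "AE x in M. left_version M F m x =
    (SUP q\<in>{q. ereal_of_rat q < m x}. F (\<lambda>_. ereal_of_rat q) x)"
proof -
  define A where "A = {x \<in> space M. m x > -\<infinity>}"
  have eq: "left_version M F m =
      glue A (ess_Sup M (F ` {n \<in> L0bar M. AE x in M. x \<in> A \<longrightarrow> n x < m x})) (\<lambda>_. -\<infinity>)"
    by (simp add: left_version_def A_def Let_def)
  show ?thesis
    using ess_Sup_eq(2)[OF ess_Sup_left_version[OF F m A_def]] AE_space
    by eventually_elim (auto simp: eq glue_apply A_def bot_ereal_def)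
qed

text \<open>Order dual of \<open>ess_Sup_left_version\<close>: off \<open>B\<close> the
  unconstrained infimum is the value of \<open>F\<close> at the constant -\<infinity>.\<close>

lemma ess_Inf_right_version:
  assumes F: "local_increasing M F" and m [measurable]: "m \<in> L0bar M"
    and B_def: "B = {x \<in> space M. m x < \<infinity>}"
  shows "is_ess_Inf M (F ` {n \<in> L0bar M. AE x in M. x \<in> B \<longrightarrow> n x > m x})
    (glue B (\<lambda>x. INF q\<in>{q. m x < ereal_of_rat q}. F (\<lambda>_. ereal_of_rat q) x) (F (\<lambda>_. -\<infinity>)))"
    (is "is_ess_Inf M (F ` ?N) (glue B ?Z _)")
proof -
  have [measurable]: "F (\<lambda>_. c) \<in> L0bar M" for c
    by (rule local_increasing_in_L0bar[OF F]) simp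
  have B [measurable]: "B \<in> sets M"
    unfolding B_def by measurable
  have "(\<lambda>x. INF q. if m x < ereal_of_rat q then F (\<lambda>_. ereal_of_rat q) x else \<infinity>) \<in> L0bar M"
    by measurable
  then have "?Z \<in> L0bar M"
    by (simp only: INF_if_eq)
  then have Z: "glue B ?Z (F (\<lambda>_. -\<infinity>)) \<in> L0bar M"
    by (intro glue_in_L0bar) simp_all
  have "AE x in M. glue B ?Z (F (\<lambda>_. -\<infinity>)) x \<le> F n x" if n: "n \<in> ?N" for n
  proof -
    have nL: "n \<in> L0bar M" and ineq: "AE x in M. x \<in> B \<longrightarrow> m x < n x"
      using n by auto
    have "AE x in M. -\<infinity> \<le> n x \<longrightarrow> F (\<lambda>_. -\<infinity>) x \<le> F n x"
      by (rule local_increasing_mono[OF F _ nL]) simp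
    then show ?thesis
      using ineq local_increasing_mono_rat[OF F nL]
    proof eventually_elim
      case (elim x)
      show ?case
      proof (cases "x \<in> B")
        case True
        then obtain q where "m x < ereal_of_rat q" "ereal_of_rat q < n x"
          using elim ereal_dense3[of "m x" "n x"] by auto
        then show ?thesis
          using True elim by (auto simp: glue_apply intro!: INF_lower2[of q])
      qed (use elim in \<open>simp add: glue_apply\<close>)
    qed
  qed
  moreover have "AE x in M. Y x \<le> glue B ?Z (F (\<lambda>_. -\<infinity>)) x"
    if Y: "Y \<in> L0bar M" "\<And>n. n \<in> ?N \<Longrightarrow> AE x in M. Y x \<le> F n x" for Y
  proof -
    define n where "n q = glue {x \<in> space M. m x < ereal_of_rat q} (\<lambda>_. ereal_of_rat q)
      (glue B (\<lambda>_. \<infinity>) (\<lambda>_. -\<infinity>))" for q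
    have nL: "n q \<in> L0bar M" for q
      unfolding n_def by (intro glue_in_L0bar) simp_all
    have "n q \<in> ?N" for q
      using nL by (auto simp: n_def glue_apply B_def)
    then have "AE x in M. \<forall>q. Y x \<le> F (n q) x"
      unfolding AE_all_countable using Y(2) by blast
    moreover have "AE x in M. \<forall>q. n q x \<le> ereal_of_rat q \<longrightarrow> F (n q) x \<le> F (\<lambda>_. ereal_of_rat q) x"
      unfolding AE_all_countable
      by (intro allI local_increasing_mono[OF F]) (simp_all add: nL)
    moreover have "AE x in M. n 0 x \<le> -\<infinity> \<longrightarrow> F (n 0) x \<le> F (\<lambda>_. -\<infinity>) x"
      by (intro local_increasing_mono[OF F]) (simp_all add: nL)
    ultimately show ?thesis
      using AE_space
    proof eventually_elim
      case (elim x)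
      show ?case
      proof (cases "x \<in> B")
        case True
        have "Y x \<le> F (\<lambda>_. ereal_of_rat q) x" if "m x < ereal_of_rat q" for q
        proof -
          have "n q x = ereal_of_rat q"
            using that elim by (simp add: n_def glue_apply)
          then show ?thesis
            using elim by (metis order_refl order_trans)
        qed
        then show ?thesis
          using True by (auto simp: glue_apply intro!: INF_greatest)
      next
        case False
        then have "n 0 x = -\<infinity>"
          using elim by (auto simp: n_def glue_apply B_def)
        then have "Y x \<le> F (\<lambda>_. -\<infinity>) x"
          using elim by (metis order_refl order_trans)
        then show ?thesis
          using False by (simp add: glue_apply)
      qed
    qed
  qed
  ultimately show ?thesis
    using Z unfolding is_ess_Inf_def by blast
qed

lemma right_version_eq:
  assumes F: "local_increasing M F" and m: "m \<in> L0bar M"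
  shows "AE x in M. right_version M F m x =
    (INF q\<in>{q. m x < ereal_of_rat q}. F (\<lambda>_. ereal_of_rat q) x)"
proof -
  define B where "B = {x \<in> space M. m x < \<infinity>}"
  have eq: "right_version M F m =
      glue B (ess_Inf M (F ` {n \<in> L0bar M. AE x in M. x \<in> B \<longrightarrow> n x > m x})) (\<lambda>_. \<infinity>)"
    by (simp add: right_version_def B_def Let_def)
  show ?thesis
    using ess_Inf_eq(2)[OF ess_Inf_right_version[OF F m B_def]] AE_space
    by eventually_elim (auto simp: eq glue_apply B_def top_ereal_def)
qed

section \<open>Left- and right-inverses as countable infima and suprema\<close>

text \<open>If \<open>m\<close> is in the family and \<open>q\<close> lies above \<open>m x\<close>,
  then on \<open>A\<close> monotonicity gives \<open>s \<le> F(m) \<le> F(q)\<close>, so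
  \<open>q\<close> is in the index set; letting \<open>q\<close> decrease to \<open>m x\<close>
  gives the lower bound. Off \<open>A\<close> the family is unconstrained and its infimum is
  -\<infinity>.\<close>

lemma ess_Inf_left_inverse:
  assumes F: "local_increasing M F" and s [measurable]: "s \<in> L0bar M"
    and A_def: "A = {x \<in> space M. F (\<lambda>_. \<infinity>) x \<ge> s x}"
  shows "is_ess_Inf M {m \<in> L0bar M. AE x in M. indicator A x * F m x \<ge> indicator A x * s x}
    (glue A (\<lambda>x. INF q\<in>{q. s x \<le> F (\<lambda>_. ereal_of_rat q) x}. ereal_of_rat q) (\<lambda>_. -\<infinity>))"
    (is "is_ess_Inf M ?N (glue A ?Z _)")
proof -
  \<comment> \<open>Off \<open>A\<close> both products with the indicator are 0, so the constraint
    there is trivially true.\<close>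
  have N: "?N = {m \<in> L0bar M. AE x in M. x \<in> A \<longrightarrow> s x \<le> F m x}"
    by (intro Collect_cong conj_cong refl AE_cong) (simp add: indicator_def)
  have [measurable]: "F (\<lambda>_. c) \<in> L0bar M" for c
    by (rule local_increasing_in_L0bar[OF F]) simp
  have A [measurable]: "A \<in> sets M"
    unfolding A_def by measurable
  have "(\<lambda>x. INF q. if s x \<le> F (\<lambda>_. ereal_of_rat q) x then ereal_of_rat q else \<infinity>) \<in> L0bar M"
    by measurable
  then have "?Z \<in> L0bar M"
    by (simp only: INF_if_eq)
  then have Z: "glue A ?Z (\<lambda>_. -\<infinity>) \<in> L0bar M"
    by (intro glue_in_L0bar) simp_all
  have "AE x in M. glue A ?Z (\<lambda>_. -\<infinity>) x \<le> m x" if m: "m \<in> ?N" for m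
  proof -
    have mL: "m \<in> L0bar M" and ineq: "AE x in M. x \<in> A \<longrightarrow> s x \<le> F m x"
      using m unfolding N by auto
    show ?thesis
      using ineq local_increasing_mono_rat[OF F mL]
    proof eventually_elim
      case (elim x)
      have "?Z x \<le> m x" if "x \<in> A"
      proof (rule ereal_le_by_rat_above)
        fix q assume "m x < ereal_of_rat q"
        then have "s x \<le> F (\<lambda>_. ereal_of_rat q) x"
          using that elim by (metis less_imp_le order_trans)
        then show "?Z x \<le> ereal_of_rat q"
          by (intro INF_lower) simp
      qed
      then show ?case
        by (simp add: glue_apply)
    qed
  qed
  moreover have "AE x in M. Y x \<le> glue A ?Z (\<lambda>_. -\<infinity>) x"
    if Y: "Y \<in> L0bar M" "\<And>n. n \<in> ?N \<Longrightarrow> AE x in M. Y x \<le> n x" for Y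
  proof -
    \<comment> \<open>A member of the family equal to \<open>q\<close> where \<open>q\<close> solves
      the constraint. On the rest of \<open>A\<close> the value \<infinity> solves it by the
      definition of \<open>A\<close>; off \<open>A\<close> the value -\<infinity> forces the bound
      \<open>Y\<close> down.\<close>
    define n where "n q = glue {x \<in> space M. s x \<le> F (\<lambda>_. ereal_of_rat q) x} (\<lambda>_. ereal_of_rat q)
      (glue A (\<lambda>_. \<infinity>) (\<lambda>_. -\<infinity>))" for q
    have nL: "n q \<in> L0bar M" for q
      unfolding n_def by (intro glue_in_L0bar) simp_all
    have top: "AE x in M. ereal_of_rat q \<le> \<infinity> \<longrightarrow> F (\<lambda>_. ereal_of_rat q) x \<le> F (\<lambda>_. \<infinity>) x" for q
      by (intro local_increasing_mono[OF F]) simp_all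
    have "n q \<in> ?N" for q
    proof -
      have "AE x in M. ereal_of_rat q \<le> n q x \<longrightarrow> F (\<lambda>_. ereal_of_rat q) x \<le> F (n q) x"
        "AE x in M. \<infinity> \<le> n q x \<longrightarrow> F (\<lambda>_. \<infinity>) x \<le> F (n q) x"
        by (intro local_increasing_mono[OF F]; simp add: nL)+
      then have "AE x in M. x \<in> A \<longrightarrow> s x \<le> F (n q) x"
        by eventually_elim (auto simp: n_def glue_apply A_def split: if_splits)
      then show ?thesis
        unfolding N using nL by simp
    qed
    then have "AE x in M. \<forall>q. Y x \<le> n q x"
      unfolding AE_all_countable using Y(2) by blast
    then show ?thesis
      \<comment> \<open>Off \<open>A\<close>, \<open>F(0) \<le> F(\<infinity>) < s\<close> rules out
        the first branch of \<open>n 0\<close>, which is therefore -\<infinity>.\<close>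
      using AE_space top[of 0]
    proof eventually_elim
      case (elim x)
      show ?case
      proof (cases "x \<in> A")
        case True
        have "Y x \<le> ereal_of_rat q" if "s x \<le> F (\<lambda>_. ereal_of_rat q) x" for q
          using elim(1)[rule_format, of q] elim(2) that by (simp add: n_def glue_apply)
        then show ?thesis
          using True by (auto simp: glue_apply intro!: INF_greatest)
      next
        case False
        then have "n 0 x = -\<infinity>"
          using elim by (auto simp: n_def glue_apply A_def)
        then show ?thesis
          using False elim(1)[rule_format, of 0] by (simp add: glue_apply)
      qed
    qed
  qed
  ultimately show ?thesis
    using Z unfolding is_ess_Inf_def by blast
qed

text \<open>Off \<open>A\<close> every \<open>F(q)\<close> is at most
  \<open>F(\<infinity>) < s\<close>, so the index set is empty and its infimum is \<infinity>. This
  is the value that the definition prescribes there.\<close>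

lemma left_inverse_eq:
  assumes F: "local_increasing M F" and s [measurable]: "s \<in> L0bar M"
  shows "left_inverse M F s \<in> L0bar M"
    and "AE x in M. left_inverse M F s x =
      (INF q\<in>{q. s x \<le> F (\<lambda>_. ereal_of_rat q) x}. ereal_of_rat q)"
proof -
  define A where "A = {x \<in> space M. F (\<lambda>_. \<infinity>) x \<ge> s x}"
  have [measurable]: "F (\<lambda>_. c) \<in> L0bar M" for c
    by (rule local_increasing_in_L0bar[OF F]) simp
  have A [measurable]: "A \<in> sets M"
    unfolding A_def by measurable
  have eq: "left_inverse M F s = glue A
      (ess_Inf M {m \<in> L0bar M. AE x in M. indicator A x * F m x \<ge> indicator A x * s x}) (\<lambda>_. \<infinity>)"
    by (simp add: left_inverse_def A_def Let_def)
  note ess_Inf = ess_Inf_eq[OF ess_Inf_left_inverse[OF F s A_def]]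
  show "left_inverse M F s \<in> L0bar M"
    unfolding eq by (intro glue_in_L0bar A ess_Inf(1)) simp
  have "AE x in M. \<forall>q. ereal_of_rat q \<le> \<infinity> \<longrightarrow> F (\<lambda>_. ereal_of_rat q) x \<le> F (\<lambda>_. \<infinity>) x"
    unfolding AE_all_countable by (intro allI local_increasing_mono[OF F]) simp_all
  then show "AE x in M. left_inverse M F s x =
      (INF q\<in>{q. s x \<le> F (\<lambda>_. ereal_of_rat q) x}. ereal_of_rat q)"
    using ess_Inf(2) AE_space
  proof eventually_elim
    case (elim x)
    show ?case
    proof (cases "x \<in> A")
      case False
      then have "{q. s x \<le> F (\<lambda>_. ereal_of_rat q) x} = {}"
        using elim by (auto simp: A_def) (meson order_trans)
      then show ?thesis
        using False by (simp add: eq glue_apply top_ereal_def)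
    qed (use elim in \<open>simp add: eq glue_apply\<close>)
  qed
qed

text \<open>Order dual of \<open>ess_Inf_left_inverse\<close>, with
  \<open>F(-\<infinity>) \<le> s\<close> making the value -\<infinity> admissible on
  \<open>B\<close>.\<close>

lemma ess_Sup_right_inverse:
  assumes F: "local_increasing M F" and s [measurable]: "s \<in> L0bar M"
    and B_def: "B = {x \<in> space M. F (\<lambda>_. -\<infinity>) x \<le> s x}"
  shows "is_ess_Sup M {m \<in> L0bar M. AE x in M. indicator B x * F m x \<le> indicator B x * s x}
    (glue B (\<lambda>x. SUP q\<in>{q. F (\<lambda>_. ereal_of_rat q) x \<le> s x}. ereal_of_rat q) (\<lambda>_. \<infinity>))"
    (is "is_ess_Sup M ?N (glue B ?Z _)")
proof -
  have N: "?N = {m \<in> L0bar M. AE x in M. x \<in> B \<longrightarrow> F m x \<le> s x}"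
    by (intro Collect_cong conj_cong refl AE_cong) (simp add: indicator_def)
  have [measurable]: "F (\<lambda>_. c) \<in> L0bar M" for c
    by (rule local_increasing_in_L0bar[OF F]) simp
  have B [measurable]: "B \<in> sets M"
    unfolding B_def by measurable
  have "(\<lambda>x. SUP q. if F (\<lambda>_. ereal_of_rat q) x \<le> s x then ereal_of_rat q else -\<infinity>) \<in> L0bar M"
    by measurable
  then have "?Z \<in> L0bar M"
    by (simp only: SUP_if_eq)
  then have Z: "glue B ?Z (\<lambda>_. \<infinity>) \<in> L0bar M"
    by (intro glue_in_L0bar) simp_all
  have "AE x in M. m x \<le> glue B ?Z (\<lambda>_. \<infinity>) x" if m: "m \<in> ?N" for m
  proof -
    have mL: "m \<in> L0bar M" and ineq: "AE x in M. x \<in> B \<longrightarrow> F m x \<le> s x"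
      using m unfolding N by auto
    show ?thesis
      using ineq local_increasing_mono_rat[OF F mL]
    proof eventually_elim
      case (elim x)
      have "m x \<le> ?Z x" if "x \<in> B"
      proof (rule ereal_le_by_rat_below)
        fix q assume "ereal_of_rat q < m x"
        then have "F (\<lambda>_. ereal_of_rat q) x \<le> s x"
          using that elim by (metis less_imp_le order_trans)
        then show "ereal_of_rat q \<le> ?Z x"
          by (intro SUP_upper) simp
      qed
      then show ?case
        by (simp add: glue_apply)
    qed
  qed
  moreover have "AE x in M. glue B ?Z (\<lambda>_. \<infinity>) x \<le> Y x"
    if Y: "Y \<in> L0bar M" "\<And>n. n \<in> ?N \<Longrightarrow> AE x in M. n x \<le> Y x" for Y
  proof -
    define n where "n q = glue {x \<in> space M. F (\<lambda>_. ereal_of_rat q) x \<le> s x} (\<lambda>_. ereal_of_rat q)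
      (glue B (\<lambda>_. -\<infinity>) (\<lambda>_. \<infinity>))" for q
    have nL: "n q \<in> L0bar M" for q
      unfolding n_def by (intro glue_in_L0bar) simp_all
    have bot: "AE x in M. -\<infinity> \<le> ereal_of_rat q \<longrightarrow> F (\<lambda>_. -\<infinity>) x \<le> F (\<lambda>_. ereal_of_rat q) x" for q
      by (intro local_increasing_mono[OF F]) simp_all
    have "n q \<in> ?N" for q
    proof -
      have "AE x in M. n q x \<le> ereal_of_rat q \<longrightarrow> F (n q) x \<le> F (\<lambda>_. ereal_of_rat q) x"
        "AE x in M. n q x \<le> -\<infinity> \<longrightarrow> F (n q) x \<le> F (\<lambda>_. -\<infinity>) x"
        by (intro local_increasing_mono[OF F]; simp add: nL)+
      then have "AE x in M. x \<in> B \<longrightarrow> F (n q) x \<le> s x"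
        by eventually_elim (auto simp: n_def glue_apply B_def split: if_splits)
      then show ?thesis
        unfolding N using nL by simp
    qed
    then have "AE x in M. \<forall>q. n q x \<le> Y x"
      unfolding AE_all_countable using Y(2) by blast
    then show ?thesis
      using AE_space bot[of 0]
    proof eventually_elim
      case (elim x)
      show ?case
      proof (cases "x \<in> B")
        case True
        have "ereal_of_rat q \<le> Y x" if "F (\<lambda>_. ereal_of_rat q) x \<le> s x" for q
          using elim(1)[rule_format, of q] elim(2) that by (simp add: n_def glue_apply)
        then show ?thesis
          using True by (auto simp: glue_apply intro!: SUP_least)
      next
        case False
        then have "n 0 x = \<infinity>"
          using elim by (auto simp: n_def glue_apply B_def)
        then show ?thesis
          using False elim(1)[rule_format, of 0] by (simp add: glue_apply)
      qed
    qed
  qed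
  ultimately show ?thesis
    using Z unfolding is_ess_Sup_def by blast
qed

lemma right_inverse_eq:
  assumes F: "local_increasing M F" and s [measurable]: "s \<in> L0bar M"
  shows "right_inverse M F s \<in> L0bar M"
    and "AE x in M. right_inverse M F s x =
      (SUP q\<in>{q. F (\<lambda>_. ereal_of_rat q) x \<le> s x}. ereal_of_rat q)"
proof -
  define B where "B = {x \<in> space M. F (\<lambda>_. -\<infinity>) x \<le> s x}"
  have [measurable]: "F (\<lambda>_. c) \<in> L0bar M" for c
    by (rule local_increasing_in_L0bar[OF F]) simp
  have B [measurable]: "B \<in> sets M"
    unfolding B_def by measurable
  have eq: "right_inverse M F s = glue B
      (ess_Sup M {m \<in> L0bar M. AE x in M. indicator B x * F m x \<le> indicator B x * s x}) (\<lambda>_. -\<infinity>)"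
    by (simp add: right_inverse_def B_def Let_def)
  note ess_Sup = ess_Sup_eq[OF ess_Sup_right_inverse[OF F s B_def]]
  show "right_inverse M F s \<in> L0bar M"
    unfolding eq by (intro glue_in_L0bar B ess_Sup(1)) simp
  have "AE x in M. \<forall>q. -\<infinity> \<le> ereal_of_rat q \<longrightarrow> F (\<lambda>_. -\<infinity>) x \<le> F (\<lambda>_. ereal_of_rat q) x"
    unfolding AE_all_countable by (intro allI local_increasing_mono[OF F]) simp_all
  then show "AE x in M. right_inverse M F s x =
      (SUP q\<in>{q. F (\<lambda>_. ereal_of_rat q) x \<le> s x}. ereal_of_rat q)"
    using ess_Sup(2) AE_space
  proof eventually_elim
    case (elim x)
    show ?case
    proof (cases "x \<in> B")
      case False
      then have "{q. F (\<lambda>_. ereal_of_rat q) x \<le> s x} = {}"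
        using elim by (auto simp: B_def) (meson order_trans)
      then show ?thesis
        using False by (simp add: eq glue_apply bot_ereal_def)
    qed (use elim in \<open>simp add: eq glue_apply\<close>)
  qed
qed

section \<open>Comparison of a map with its one-sided versions\<close>

lemma left_version_le:
  assumes F: "local_increasing M F" and m: "m \<in> L0bar M"
  shows "AE x in M. left_version M F m x \<le> F m x"
  using left_version_eq[OF F m] local_increasing_mono_rat[OF F m]
  by eventually_elim (auto intro!: SUP_least)

lemma right_version_ge:
  assumes F: "local_increasing M F" and m: "m \<in> L0bar M"
  shows "AE x in M. F m x \<le> right_version M F m x"
  using right_version_eq[OF F m] local_increasing_mono_rat[OF F m]
  by eventually_elim (auto intro!: INF_greatest)

text \<open>A rational \<open>q\<close> strictly between \<open>n x\<close> and \<open>m x\<close>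
  gives \<open>F(n) \<le> F(q)\<close>, and \<open>F(q)\<close> is a term of the supremum.\<close>

lemma le_left_version:
  assumes F: "local_increasing M F" and m: "m \<in> L0bar M" and n: "n \<in> L0bar M"
  shows "AE x in M. n x < m x \<longrightarrow> F n x \<le> left_version M F m x"
  using left_version_eq[OF F m] local_increasing_mono_rat[OF F n]
proof eventually_elim
  case (elim x)
  show ?case
  proof
    assume "n x < m x"
    then obtain q where "n x < ereal_of_rat q" "ereal_of_rat q < m x"
      using ereal_dense3 by blast
    then show "F n x \<le> left_version M F m x"
      using elim by (auto intro!: SUP_upper2[of q])
  qed
qed

lemma right_version_le:
  assumes F: "local_increasing M F" and m: "m \<in> L0bar M" and n: "n \<in> L0bar M"
  shows "AE x in M. m x < n x \<longrightarrow> right_version M F m x \<le> F n x"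
  using right_version_eq[OF F m] local_increasing_mono_rat[OF F n]
proof eventually_elim
  case (elim x)
  show ?case
  proof
    assume "m x < n x"
    then obtain q where "m x < ereal_of_rat q" "ereal_of_rat q < n x"
      using ereal_dense3 by blast
    then show "right_version M F m x \<le> F n x"
      using elim by (auto intro!: INF_lower2[of q])
  qed
qed

section \<open>A symmetric form of the inverse relation\<close>

text \<open>Strict premises with weak conclusions leave \<open>G\<close> free to take any value
  between the ends of a stretch where \<open>F\<close> is constant. The extreme values of
  \<open>F\<close> are covered by letting \<open>p\<close> be an infinite constant.\<close>

definition cross_inverse ::
  "'a measure \<Rightarrow> (('a \<Rightarrow> ereal) \<Rightarrow> ('a \<Rightarrow> ereal)) \<Rightarrow> (('a \<Rightarrow> ereal) \<Rightarrow> ('a \<Rightarrow> ereal)) \<Rightarrow> bool" where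
  "cross_inverse M F G \<longleftrightarrow> (\<forall>p\<in>L0bar M. \<forall>t\<in>L0bar M.
     AE x in M. (F p x < t x \<longrightarrow> p x \<le> G t x) \<and> (t x < F p x \<longrightarrow> G t x \<le> p x))"

text \<open>Contraposition turns each of the two implications into the corresponding one with the
  roles of \<open>F\<close> and \<open>G\<close> exchanged.\<close>

lemma cross_inverse_commute: "cross_inverse M F G \<longleftrightarrow> cross_inverse M G F"
proof -
  have "cross_inverse M G F" if "cross_inverse M F G" for F G
    unfolding cross_inverse_def
  proof (intro ballI)
    fix t p assume "t \<in> L0bar M" "p \<in> L0bar M"
    then have "AE x in M. (F p x < t x \<longrightarrow> p x \<le> G t x) \<and> (t x < F p x \<longrightarrow> G t x \<le> p x)"
      using that by (simp add: cross_inverse_def)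
    then show "AE x in M. (G t x < p x \<longrightarrow> t x \<le> F p x) \<and> (p x < G t x \<longrightarrow> F p x \<le> t x)"
      by eventually_elim (metis not_le)
  qed
  then show ?thesis
    by blast
qed

lemma cross_inverse_rats:
  assumes "cross_inverse M F G" and "t \<in> L0bar M"
  shows "AE x in M. \<forall>q. (F (\<lambda>_. ereal_of_rat q) x < t x \<longrightarrow> ereal_of_rat q \<le> G t x) \<and>
                        (t x < F (\<lambda>_. ereal_of_rat q) x \<longrightarrow> G t x \<le> ereal_of_rat q)"
  using assms unfolding cross_inverse_def AE_all_countable by simp

text \<open>Strictly between \<open>F(-\<infinity>)\<close> and \<open>F(\<infinity>)\<close> the
  one-sided versions of \<open>F\<close> at \<open>G s\<close> give the claim. Monotonicity of
  \<open>G\<close> along rational constants then carries it to every \<open>t\<close>.\<close>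

lemma conditional_inverse_imp_cross_inverse:
  assumes F: "local_increasing M F" and inv: "conditional_inverse M F G"
  shows "cross_inverse M F G"
  unfolding cross_inverse_def
proof (intro ballI)
  fix p t assume p: "p \<in> L0bar M" and t: "t \<in> L0bar M"
  have G: "local_increasing M G"
    using inv by (simp add: conditional_inverse_def)
  have "AE x in M. -\<infinity> \<le> p x \<longrightarrow> F (\<lambda>_. -\<infinity>) x \<le> F p x"
    by (intro local_increasing_mono[OF F] p) simp
  moreover have "AE x in M. p x \<le> \<infinity> \<longrightarrow> F p x \<le> F (\<lambda>_. \<infinity>) x"
    by (intro local_increasing_mono[OF F] p) simp
  ultimately have bounds: "AE x in M. F (\<lambda>_. -\<infinity>) x \<le> F p x \<and> F p x \<le> F (\<lambda>_. \<infinity>) x"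
    by eventually_elim simp
  \<comment> \<open>If \<open>F(p) < s\<close> but \<open>G(s) < p\<close>, then \<open>s\<close> is
    at most the right version of \<open>F\<close> at \<open>G(s)\<close>, which is at most
    \<open>F(p)\<close>: a contradiction. The other half uses the left version.\<close>
  have inner: "AE x in M. F (\<lambda>_. -\<infinity>) x < s x \<and> s x < F (\<lambda>_. \<infinity>) x \<longrightarrow>
      (F p x < s x \<longrightarrow> p x \<le> G s x) \<and> (s x < F p x \<longrightarrow> G s x \<le> p x)" if s: "s \<in> L0bar M" for s
  proof -
    have Gs: "G s \<in> L0bar M"
      using G s by (rule local_increasing_in_L0bar)
    have "AE x in M. F (\<lambda>_. -\<infinity>) x < s x \<and> s x < F (\<lambda>_. \<infinity>) x \<longrightarrow>
        left_version M F (G s) x \<le> s x \<and> s x \<le> right_version M F (G s) x"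
      using inv s by (simp add: conditional_inverse_def)
    then show ?thesis
      using le_left_version[OF F Gs p] right_version_le[OF F Gs p]
    proof eventually_elim
      case (elim x)
      show ?case
      proof (intro impI conjI; rule ccontr)
        assume "F (\<lambda>_. -\<infinity>) x < s x \<and> s x < F (\<lambda>_. \<infinity>) x" "F p x < s x" "\<not> p x \<le> G s x"
        then have "s x \<le> F p x"
          using elim by (auto intro: order_trans)
        with \<open>F p x < s x\<close> show False
          by simp
      next
        assume "F (\<lambda>_. -\<infinity>) x < s x \<and> s x < F (\<lambda>_. \<infinity>) x" "s x < F p x" "\<not> G s x \<le> p x"
        then have "F p x \<le> s x"
          using elim by (auto intro: order_trans)
        with \<open>s x < F p x\<close> show False
          by simp
      qed
    qed
  qed
  have "AE x in M. \<forall>q. F (\<lambda>_. -\<infinity>) x < ereal_of_rat q \<and> ereal_of_rat q < F (\<lambda>_. \<infinity>) x \<longrightarrow>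
      (F p x < ereal_of_rat q \<longrightarrow> p x \<le> G (\<lambda>_. ereal_of_rat q) x) \<and>
      (ereal_of_rat q < F p x \<longrightarrow> G (\<lambda>_. ereal_of_rat q) x \<le> p x)"
    unfolding AE_all_countable using inner by simp
  moreover have "AE x in M. t x < F (\<lambda>_. -\<infinity>) x \<longrightarrow> G t x = -\<infinity>"
    "AE x in M. F (\<lambda>_. \<infinity>) x < t x \<longrightarrow> G t x = \<infinity>"
    using inv t by (simp_all add: conditional_inverse_def)
  ultimately show "AE x in M. (F p x < t x \<longrightarrow> p x \<le> G t x) \<and> (t x < F p x \<longrightarrow> G t x \<le> p x)"
    using bounds local_increasing_mono_rat[OF G t]
  proof eventually_elim
    case (elim x)
    note rat = elim(1)[rule_format] and low = elim(2) and high = elim(3)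
      and bounds = elim(4) and mono = elim(5)[rule_format]
    \<comment> \<open>The definition says nothing about \<open>G\<close> at \<open>s = F(\<plusminus>\<infinity>)\<close>, so pass to a rational strictly
      between \<open>F(p)\<close> and \<open>t\<close>.\<close>
    have "p x \<le> G t x" if less: "F p x < t x"
    proof -
      obtain q where q: "F p x < ereal_of_rat q" "ereal_of_rat q < t x"
        using less ereal_dense3 by blast
      show ?thesis
      \<comment> \<open>If \<open>q\<close> is below \<open>F(\<infinity>)\<close>, it lies in the
        open range, since \<open>F(-\<infinity>) \<le> F(p) < q\<close>. Otherwise \<open>t\<close>
        exceeds \<open>F(\<infinity>)\<close> and \<open>G(t)\<close> is \<infinity> by
        definition.\<close>
      proof (cases "ereal_of_rat q < F (\<lambda>_. \<infinity>) x")
        case True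
        then have "p x \<le> G (\<lambda>_. ereal_of_rat q) x"
          using rat[of q] bounds q by (metis le_less_trans)
        also have "\<dots> \<le> G t x"
          using mono[of q] q by simp
        finally show ?thesis .
      next
        case False
        then have "F (\<lambda>_. \<infinity>) x < t x"
          using q by simp
        then show ?thesis
          using high by simp
      qed
    qed
    moreover have "G t x \<le> p x" if less: "t x < F p x"
    proof -
      obtain q where q: "t x < ereal_of_rat q" "ereal_of_rat q < F p x"
        using less ereal_dense3 by blast
      show ?thesis
      proof (cases "F (\<lambda>_. -\<infinity>) x < ereal_of_rat q")
        case True
        have "G t x \<le> G (\<lambda>_. ereal_of_rat q) x"
          using mono[of q] q by simp
        also have "\<dots> \<le> p x"
          using True rat[of q] bounds q by (metis less_le_trans)
        finally show ?thesis .
      next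
        case False
        then have "t x < F (\<lambda>_. -\<infinity>) x"
          using q by simp
        then show ?thesis
          using low by simp
      qed
    qed
    ultimately show ?case
      by blast
  qed
qed

text \<open>If \<open>q < G(s)\<close>, then \<open>s < F(q)\<close> is impossible, so every term of
  the supremum for the left version is at most \<open>s\<close>; the right version is dual.\<close>

lemma cross_inverse_imp_conditional_inverse:
  assumes F: "local_increasing M F" and G: "local_increasing M G"
    and inv: "cross_inverse M F G"
  shows "conditional_inverse M F G"
  unfolding conditional_inverse_def
proof (intro conjI ballI)
  fix s assume s: "s \<in> L0bar M"
  have Gs: "G s \<in> L0bar M"
    using G s by (rule local_increasing_in_L0bar)
  show "AE x in M. F (\<lambda>_. -\<infinity>) x < s x \<and> s x < F (\<lambda>_. \<infinity>) x \<longrightarrow>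
      left_version M F (G s) x \<le> s x \<and> s x \<le> right_version M F (G s) x"
    using cross_inverse_rats[OF inv s] left_version_eq[OF F Gs] right_version_eq[OF F Gs]
  proof eventually_elim
    case (elim x)
    have "left_version M F (G s) x \<le> s x"
      unfolding elim(2) using elim(1) by (intro SUP_least) (metis mem_Collect_eq not_le)
    moreover have "s x \<le> right_version M F (G s) x"
      unfolding elim(3) using elim(1) by (intro INF_greatest) (metis mem_Collect_eq not_le)
    ultimately show ?case
      by blast
  qed
  \<comment> \<open>Taking \<open>p\<close> to be the constant -\<infinity> or \<infinity> yields
    the two outer clauses: only -\<infinity> is \<le> -\<infinity>, and only \<infinity> is \<ge>
    \<infinity>.\<close>
  have inv': "AE x in M. (F (\<lambda>_. c) x < s x \<longrightarrow> c \<le> G s x) \<and> (s x < F (\<lambda>_. c) x \<longrightarrow> G s x \<le> c)" for c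
    using bspec[OF bspec[OF inv[unfolded cross_inverse_def], of "\<lambda>_. c"] s] by simp
  show "AE x in M. s x < F (\<lambda>_. -\<infinity>) x \<longrightarrow> G s x = -\<infinity>"
    using inv'[of "-\<infinity>"] by eventually_elim simp
  show "AE x in M. F (\<lambda>_. \<infinity>) x < s x \<longrightarrow> G s x = \<infinity>"
    using inv'[of "\<infinity>"] by eventually_elim simp
qed (rule G)

section \<open>The left- and right-inverses are conditional inverses\<close>

text \<open>If \<open>F(p) < t \<le> F(q)\<close>, monotonicity forces \<open>p \<le> q\<close>, so
  \<open>p\<close> is below the infimum. If \<open>t < F(p)\<close>, every rational above
  \<open>p\<close> is in the index set, so the infimum is at most \<open>p\<close>.\<close>

lemma conditional_inverse_left_inverse:
  assumes F: "local_increasing M F"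
  shows "conditional_inverse M F (left_inverse M F)"
proof (rule cross_inverse_imp_conditional_inverse[OF F])
  show "local_increasing M (left_inverse M F)"
  proof (rule local_increasingI)
    fix s s' assume s: "s \<in> L0bar M" "s' \<in> L0bar M"
    \<comment> \<open>A larger \<open>s\<close> leaves fewer rationals in the index set, hence a
      larger infimum.\<close>
    show "AE x in M. s x \<le> s' x \<longrightarrow> left_inverse M F s x \<le> left_inverse M F s' x"
      using left_inverse_eq(2)[OF F s(1)] left_inverse_eq(2)[OF F s(2)]
      by eventually_elim (auto intro!: INF_superset_mono)
  qed (rule left_inverse_eq(1)[OF F])
  show "cross_inverse M F (left_inverse M F)"
    unfolding cross_inverse_def
  proof (intro ballI)
    fix p t assume p: "p \<in> L0bar M" and t: "t \<in> L0bar M"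
    show "AE x in M. (F p x < t x \<longrightarrow> p x \<le> left_inverse M F t x) \<and>
        (t x < F p x \<longrightarrow> left_inverse M F t x \<le> p x)"
      using left_inverse_eq(2)[OF F t] local_increasing_mono_rat[OF F p]
    proof eventually_elim
      case (elim x)
      have "p x \<le> left_inverse M F t x" if "F p x < t x"
        unfolding elim(1) using elim(2) that
        by (intro INF_greatest) (metis le_less_trans linear mem_Collect_eq not_le)
      moreover have "left_inverse M F t x \<le> p x" if "t x < F p x"
      proof (rule ereal_le_by_rat_above)
        fix q assume "p x < ereal_of_rat q"
        then have "t x \<le> F (\<lambda>_. ereal_of_rat q) x"
          using elim(2) that by (meson less_imp_le order_trans)
        then show "left_inverse M F t x \<le> ereal_of_rat q"
          unfolding elim(1) by (intro INF_lower) simp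
      qed
      ultimately show ?case
        by blast
    qed
  qed
qed

lemma conditional_inverse_right_inverse:
  assumes F: "local_increasing M F"
  shows "conditional_inverse M F (right_inverse M F)"
proof (rule cross_inverse_imp_conditional_inverse[OF F])
  show "local_increasing M (right_inverse M F)"
  proof (rule local_increasingI)
    fix s s' assume s: "s \<in> L0bar M" "s' \<in> L0bar M"
    show "AE x in M. s x \<le> s' x \<longrightarrow> right_inverse M F s x \<le> right_inverse M F s' x"
      using right_inverse_eq(2)[OF F s(1)] right_inverse_eq(2)[OF F s(2)]
      by eventually_elim (auto intro!: SUP_subset_mono)
  qed (rule right_inverse_eq(1)[OF F])
  show "cross_inverse M F (right_inverse M F)"
    unfolding cross_inverse_def
  proof (intro ballI)
    fix p t assume p: "p \<in> L0bar M" and t: "t \<in> L0bar M"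
    show "AE x in M. (F p x < t x \<longrightarrow> p x \<le> right_inverse M F t x) \<and>
        (t x < F p x \<longrightarrow> right_inverse M F t x \<le> p x)"
      using right_inverse_eq(2)[OF F t] local_increasing_mono_rat[OF F p]
    proof eventually_elim
      case (elim x)
      have "right_inverse M F t x \<le> p x" if "t x < F p x"
        unfolding elim(1) using elim(2) that
        by (intro SUP_least) (metis less_le_trans linear mem_Collect_eq not_le)
      moreover have "p x \<le> right_inverse M F t x" if "F p x < t x"
      proof (rule ereal_le_by_rat_below)
        fix q assume "ereal_of_rat q < p x"
        then have "F (\<lambda>_. ereal_of_rat q) x \<le> t x"
          using elim(2) that by (meson less_imp_le order_trans)
        then show "ereal_of_rat q \<le> right_inverse M F t x"
          unfolding elim(1) by (intro SUP_upper) simp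
      qed
      ultimately show ?case
        by blast
    qed
  qed
qed

section \<open>One-sided versions of a conditional inverse\<close>

lemma cross_inverse_rats_rats:
  assumes inv: "cross_inverse M F G"
  shows "AE x in M. \<forall>p t.
    (F (\<lambda>_. ereal_of_rat p) x < ereal_of_rat t \<longrightarrow> ereal_of_rat p \<le> G (\<lambda>_. ereal_of_rat t) x) \<and>
    (ereal_of_rat t < F (\<lambda>_. ereal_of_rat p) x \<longrightarrow> G (\<lambda>_. ereal_of_rat t) x \<le> ereal_of_rat p)"
  unfolding AE_all_countable using inv by (simp add: cross_inverse_def)

text \<open>A rational \<open>p\<close> below the infimum satisfies \<open>F(p) < t < s\<close> for
  some rational \<open>t\<close>, and the cross condition gives \<open>p \<le> G(t)\<close>, a term
  of the supremum. Conversely \<open>t < s \<le> F(q)\<close> gives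
  \<open>G(t) \<le> q\<close>.\<close>

lemma left_inverse_eq_left_version:
  assumes F: "local_increasing M F" and G: "local_increasing M G"
    and inv: "cross_inverse M F G" and s: "s \<in> L0bar M"
  shows "AE x in M. left_inverse M F s x = left_version M G s x"
  using left_inverse_eq(2)[OF F s] left_version_eq[OF G s] cross_inverse_rats_rats[OF inv]
proof eventually_elim
  case (elim x)
  note inv = elim(3)[rule_format]
  show ?case
  proof (rule antisym)
    show "left_inverse M F s x \<le> left_version M G s x"
    proof (rule ereal_le_by_rat_below)
      fix p assume "ereal_of_rat p < left_inverse M F s x"
      \<comment> \<open>Otherwise \<open>p\<close> would be in the index set and the infimum would
        be at most \<open>p\<close>.\<close>
      then have "F (\<lambda>_. ereal_of_rat p) x < s x"
        unfolding elim(1) by (rule contrapos_pp) (simp add: not_less, rule INF_lower, simp)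
      then obtain t where t: "F (\<lambda>_. ereal_of_rat p) x < ereal_of_rat t" "ereal_of_rat t < s x"
        using ereal_dense3 by blast
      then show "ereal_of_rat p \<le> left_version M G s x"
        unfolding elim(2) using inv[of p t] by (auto intro!: SUP_upper2[of t])
    qed
    show "left_version M G s x \<le> left_inverse M F s x"
      unfolding elim(1,2)
    proof (intro SUP_least INF_greatest)
      fix t q assume "t \<in> {q. ereal_of_rat q < s x}" "q \<in> {q. s x \<le> F (\<lambda>_. ereal_of_rat q) x}"
      then have "ereal_of_rat t < F (\<lambda>_. ereal_of_rat q) x"
        by auto
      then show "G (\<lambda>_. ereal_of_rat t) x \<le> ereal_of_rat q"
        using inv[of q t] by blast
    qed
  qed
qed

lemma right_version_eq_right_inverse:
  assumes F: "local_increasing M F" and G: "local_increasing M G"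
    and inv: "cross_inverse M F G" and s: "s \<in> L0bar M"
  shows "AE x in M. right_version M G s x = right_inverse M F s x"
  using right_inverse_eq(2)[OF F s] right_version_eq[OF G s] cross_inverse_rats_rats[OF inv]
proof eventually_elim
  case (elim x)
  note inv = elim(3)[rule_format]
  show ?case
  proof (rule antisym)
    show "right_version M G s x \<le> right_inverse M F s x"
    proof (rule ereal_le_by_rat_above)
      fix p assume "right_inverse M F s x < ereal_of_rat p"
      then have "s x < F (\<lambda>_. ereal_of_rat p) x"
        unfolding elim(1) by (rule contrapos_pp) (simp add: not_less, rule SUP_upper, simp)
      then obtain t where t: "s x < ereal_of_rat t" "ereal_of_rat t < F (\<lambda>_. ereal_of_rat p) x"
        using ereal_dense3 by blast
      then show "right_version M G s x \<le> ereal_of_rat p"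
        unfolding elim(2) using inv[of p t] by (auto intro!: INF_lower2[of t])
    qed
    show "right_inverse M F s x \<le> right_version M G s x"
      unfolding elim(1,2)
    proof (intro SUP_least INF_greatest)
      fix t q assume "t \<in> {q. s x < ereal_of_rat q}" "q \<in> {q. F (\<lambda>_. ereal_of_rat q) x \<le> s x}"
      then have "F (\<lambda>_. ereal_of_rat q) x < ereal_of_rat t"
        by auto
      then show "ereal_of_rat q \<le> G (\<lambda>_. ereal_of_rat t) x"
        using inv[of q t] by blast
    qed
  qed
qed

section \<open>Adjointness between one-sided versions and inverses\<close>

text \<open>A pointwise Galois connection. Forward, every rational \<open>q < m\<close> has
  \<open>F(q) \<le> s\<close> and so enters the supremum defining the inverse. Backward,
  \<open>q < m\<close> lies strictly below that supremum, so some \<open>p > q\<close> has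
  \<open>F(p) \<le> s\<close>, and \<open>F(q) \<le> F(p)\<close>.\<close>

lemma left_version_le_iff:
  assumes F: "local_increasing M F" and m: "m \<in> L0bar M" and s: "s \<in> L0bar M"
  shows "AE x in M. left_version M F m x \<le> s x \<longleftrightarrow> m x \<le> right_inverse M F s x"
  using left_version_eq[OF F m] right_inverse_eq(2)[OF F s] local_increasing_mono_rats[OF F]
proof eventually_elim
  case (elim x)
  show ?case
  proof
    assume le: "left_version M F m x \<le> s x"
    show "m x \<le> right_inverse M F s x"
    proof (rule ereal_le_by_rat_below)
      fix q assume "ereal_of_rat q < m x"
      then have "F (\<lambda>_. ereal_of_rat q) x \<le> s x"
        using le by (auto simp: elim(1) SUP_le_iff)
      then show "ereal_of_rat q \<le> right_inverse M F s x"
        unfolding elim(2) by (intro SUP_upper) simp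
    qed
  next
    assume le: "m x \<le> right_inverse M F s x"
    show "left_version M F m x \<le> s x"
      unfolding elim(1)
    proof (rule SUP_least)
      fix q assume "q \<in> {q. ereal_of_rat q < m x}"
      then have "ereal_of_rat q < right_inverse M F s x"
        using le by auto
      then obtain p where "F (\<lambda>_. ereal_of_rat p) x \<le> s x" "q < p"
        unfolding elim(2) less_SUP_iff by (auto simp: of_rat_less)
      then show "F (\<lambda>_. ereal_of_rat q) x \<le> s x"
        using elim(3) by (meson less_imp_le order_trans)
    qed
  qed
qed

lemma right_version_ge_iff:
  assumes F: "local_increasing M F" and m: "m \<in> L0bar M" and s: "s \<in> L0bar M"
  shows "AE x in M. right_version M F m x \<ge> s x \<longleftrightarrow> m x \<ge> left_inverse M F s x"
  using right_version_eq[OF F m] left_inverse_eq(2)[OF F s] local_increasing_mono_rats[OF F]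
proof eventually_elim
  case (elim x)
  show ?case
  proof
    assume le: "s x \<le> right_version M F m x"
    show "left_inverse M F s x \<le> m x"
    proof (rule ereal_le_by_rat_above)
      fix q assume "m x < ereal_of_rat q"
      then have "s x \<le> F (\<lambda>_. ereal_of_rat q) x"
        using le by (auto simp: elim(1) le_INF_iff)
      then show "left_inverse M F s x \<le> ereal_of_rat q"
        unfolding elim(2) by (intro INF_lower) simp
    qed
  next
    assume le: "left_inverse M F s x \<le> m x"
    show "s x \<le> right_version M F m x"
      unfolding elim(1)
    proof (rule INF_greatest)
      fix q assume "q \<in> {q. m x < ereal_of_rat q}"
      then have "left_inverse M F s x < ereal_of_rat q"
        using le by auto
      then obtain p where "s x \<le> F (\<lambda>_. ereal_of_rat p) x" "p < q"
        unfolding elim(2) INF_less_iff by (auto simp: of_rat_less)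
      then show "s x \<le> F (\<lambda>_. ereal_of_rat q) x"
        using elim(3) by (meson less_imp_le order_trans)
    qed
  qed
qed

section \<open>The four claims assembled\<close>

theorem propositionA9:
  fixes M :: "'a measure"
    and F :: "('a \<Rightarrow> ereal) \<Rightarrow> ('a \<Rightarrow> ereal)"
  assumes "prob_space M"
    and "local_increasing M F"
  shows
    "(\<forall>G. conditional_inverse M F G \<longrightarrow>
        (\<forall>s\<in>L0bar M. AE x in M.
            left_inverse M F s x = left_version M G s x \<and>
            left_version M G s x \<le> G s x \<and>
            G s x \<le> right_version M G s x \<and>
            right_version M G s x = right_inverse M F s x)) \<and>
     (conditional_inverse M F (left_inverse M F) \<and>
      conditional_inverse M F (right_inverse M F)) \<and>
     (\<forall>G. conditional_inverse M F G \<longrightarrow> conditional_inverse M G F) \<and>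
     (\<forall>m\<in>L0bar M. \<forall>s\<in>L0bar M.
        ((AE x in M. left_version M F m x \<le> s x) \<longleftrightarrow> (AE x in M. m x \<le> right_inverse M F s x)) \<and>
        ((AE x in M. right_version M F m x \<ge> s x) \<longleftrightarrow> (AE x in M. m x \<ge> left_inverse M F s x)))"
proof (intro conjI allI impI ballI)
  note F = assms(2)
  have G: "local_increasing M G" "cross_inverse M F G" if "conditional_inverse M F G" for G
    using that conditional_inverse_imp_cross_inverse[OF F that]
    by (simp_all add: conditional_inverse_def)
  {
    fix G s assume inv: "conditional_inverse M F G" and s: "s \<in> L0bar M"
    show "AE x in M. left_inverse M F s x = left_version M G s x \<and>
        left_version M G s x \<le> G s x \<and> G s x \<le> right_version M G s x \<and>
        right_version M G s x = right_inverse M F s x"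
      using left_inverse_eq_left_version[OF F G[OF inv] s] left_version_le[OF G(1)[OF inv] s]
        right_version_ge[OF G(1)[OF inv] s] right_version_eq_right_inverse[OF F G[OF inv] s]
      by eventually_elim blast
  next
    show "conditional_inverse M F (left_inverse M F)"
      by (rule conditional_inverse_left_inverse[OF F])
    show "conditional_inverse M F (right_inverse M F)"
      by (rule conditional_inverse_right_inverse[OF F])
  next
    fix G assume inv: "conditional_inverse M F G"
    show "conditional_inverse M G F"
      \<comment> \<open>The cross condition is symmetric, so it can be read back as a conditional
        inverse with \<open>F\<close> and \<open>G\<close> exchanged.\<close>
      using G[OF inv] F cross_inverse_commute
      by (blast intro: cross_inverse_imp_conditional_inverse)
  next
    fix m s assume m: "m \<in> L0bar M" and s: "s \<in> L0bar M"
    show "(AE x in M. left_version M F m x \<le> s x) \<longleftrightarrow> (AE x in M. m x \<le> right_inverse M F s x)"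
      \<comment> \<open>The two inequalities are equivalent at almost every point, so one holds
        almost surely exactly when the other does.\<close>
      using left_version_le_iff[OF F m s] by (rule eventually_subst)
    show "(AE x in M. right_version M F m x \<ge> s x) \<longleftrightarrow> (AE x in M. m x \<ge> left_inverse M F s x)"
      using right_version_ge_iff[OF F m s] by (rule eventually_subst)
  }
qed

end
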